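(* Let $n$ be an odd positive integer with exactly two distinct prime factors. Then $n$ is exactly $3$-deficient-perfect if and only if $n = 1521 = 3^2\cdot 13^2$; moreover, $1521$ is exactly $3$-deficient-perfect with deficient divisors $d_1=507$, $d_2=117$, $d_3=39$, i.e. $\sigma(1521) = 2\cdot 1521 - (507+117+39)$.
   Context: For a positive integer $n$, $\sigma(n)$ denotes the sum of all positive divisors of $n$. For a positive integer $k$, $n$ is called exactly $k$-deficient-perfect with deficient divisors $d_1,\dots,d_k$ if $d_1,\dots,d_k$ are distinct proper divisors of $n$ (positive divisors less than $n$) and $\sigma(n) = 2n-(d_1+d_2+\cdots+d_k)$; $n$ is exactly $k$-deficient-perfect if such divisors exist. *)

theory Defs
  imports "HOL-Computational_Algebra.Primes"
begin

definition divisor_sum :: "nat \<Rightarrow> nat" where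
  "divisor_sum n = (\<Sum>d | d dvd n. d)"

definition proper_divisor :: "nat \<Rightarrow> nat \<Rightarrow> bool" where
  "proper_divisor d n \<longleftrightarrow> 0 < d \<and> d dvd n \<and> d < n"

(* The list ds plays the role of d_1, ..., d_k, with k = length ds. The equation is
   stated over the integers because subtraction on nat truncates. *)
definition deficient_perfect_with :: "nat \<Rightarrow> nat list \<Rightarrow> bool" where
  "deficient_perfect_with n ds \<longleftrightarrow>
     0 < n \<and> ds \<noteq> [] \<and> distinct ds \<and> (\<forall>d\<in>set ds. proper_divisor d n) \<and>
     int (divisor_sum n) = 2 * int n - int (sum_list ds)"

definition exactly_deficient_perfect :: "nat \<Rightarrow> nat \<Rightarrow> bool" where
  "exactly_deficient_perfect k n \<longleftrightarrow>
     (\<exists>ds. length ds = k \<and> deficient_perfect_with n ds)"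

end

(* Let n = p^a q^b with p < q. Dividing sigma(n) = 2n - (d1 + d2 + d3) by n gives

     (p - u)(q - v) / ((p - 1)(q - 1)) + 1/e1 + 1/e2 + 1/e3 = 2,    u = p^-a,  v = q^-b,

   with distinct divisors e_i = n/d_i > 1 of n. The product is less than pq/((p - 1)(q - 1)), so the left-hand
   side is below 2 unless p = 3 and q < 83. As all d_i are odd, so is sigma(n), hence a and b are even.
   For each remaining q a branch-and-bound search over u, v and the e_i leaves only n = 1521 and n = 225.
   The search is finite for a parity reason: if u, v or both are replaced by 0, clearing denominators would
   equate an odd and an even number, so 2 is not a limit of values of the left-hand side with n unbounded. *)

theory Submission
  imports Defs Complex_Main
begin

subsection \<open>Divisors of numbers with two prime factors\<close>

text \<open>Compared with \<open>1 / M\<close>, an element outside \<open>S\<close> gains nothing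
  because it is at least \<open>M\<close>. An element of \<open>S\<close> gains
  \<open>1 / e - 1 / M\<close>, which is nonnegative, so all of \<open>S\<close> may be counted,
  whether or not it lies in \<open>E\<close>.\<close>

lemma sum_inverse_le:
  fixes E S :: "nat set"
  assumes "finite E" "finite S" "E \<subseteq> S \<union> {M..}" "S \<subseteq> {1..M}" "0 < M"
  shows "(\<Sum>e\<in>E. 1 / real e) \<le> card E / M + (\<Sum>e\<in>S. 1 / e - 1 / M)"
proof -
  have "(\<Sum>e\<in>E - S. 1 / real e - 1 / M) \<le> 0"
  proof (rule sum_nonpos)
    fix e assume "e \<in> E - S"
    with assms(3) have "M \<le> e" by blast
    then show "1 / real e - 1 / M \<le> 0"
      using \<open>0 < M\<close> frac_le[of 1 1 "real M" "real e"] by simp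
  qed
  then have "(\<Sum>e\<in>E. 1 / real e - 1 / M) \<le> (\<Sum>e\<in>E \<inter> S. 1 / real e - 1 / M)"
    using sum.Int_Diff[OF \<open>finite E\<close>, of "\<lambda>e. 1 / real e - 1 / M" S] by linarith
  also have "\<dots> \<le> (\<Sum>e\<in>S. 1 / real e - 1 / M)"
  proof (rule sum_mono2)
    fix e assume "e \<in> S - E \<inter> S"
    with assms(4) have "1 \<le> e" "e \<le> M" by auto
    then show "0 \<le> 1 / real e - 1 / M"
      using frac_le[of 1 1 "real e" "real M"] by simp
  qed (use assms in auto)
  finally show ?thesis by (simp add: sum_subtractf)
qed

lemma prime_powers_cancel:
  fixes p q :: nat
  assumes "prime p" "prime q" "p \<noteq> q" "p ^ i * q ^ j = p ^ k * q ^ l"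
  shows "i = k \<and> j = l"
proof -
  have co: "coprime (p ^ x) (q ^ y)" for x y
    using assms by (simp add: primes_coprime)
  have "p ^ i dvd p ^ k * q ^ l" "p ^ k dvd p ^ i * q ^ j" "q ^ j dvd p ^ k * q ^ l" "q ^ l dvd p ^ i * q ^ j"
    using dvd_triv_left[of "p ^ i" "q ^ j"] dvd_triv_left[of "p ^ k" "q ^ l"]
      dvd_triv_right[of "q ^ j" "p ^ i"] dvd_triv_right[of "q ^ l" "p ^ k"] assms(4) by auto
  with co have "p ^ i dvd p ^ k" "p ^ k dvd p ^ i" "q ^ j dvd q ^ l" "q ^ l dvd q ^ j"
    by (simp_all add: coprime_dvd_mult_left_iff coprime_dvd_mult_right_iff coprime_commute)
  then have "p ^ i = p ^ k" "q ^ j = q ^ l"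
    by (simp_all add: dvd_antisym)
  then show ?thesis
    using assms prime_gt_1_nat[of p] prime_gt_1_nat[of q] by simp
qed

lemma dvd_two_prime_powers_iff:
  fixes p q :: nat
  assumes "prime p" "prime q"
  shows "d dvd p ^ a * q ^ b \<longleftrightarrow> (\<exists>i\<le>a. \<exists>j\<le>b. d = p ^ i * q ^ j)"
proof
  assume "d dvd p ^ a * q ^ b"
  then obtain x y where "d = x * y" "x dvd p ^ a" "y dvd q ^ b"
    using division_decomp by blast
  then show "\<exists>i\<le>a. \<exists>j\<le>b. d = p ^ i * q ^ j"
    using assms by (auto simp: divides_primepow_nat)
qed (auto intro: mult_dvd_mono le_imp_power_dvd)

lemma divisor_sum_two_prime_powers:
  assumes "prime p" "prime q" "p \<noteq> q"
  shows "divisor_sum (p ^ a * q ^ b) = (\<Sum>i\<le>a. p ^ i) * (\<Sum>j\<le>b. q ^ j)"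
proof -
  have "{d. d dvd p ^ a * q ^ b} = (\<lambda>(i, j). p ^ i * q ^ j) ` ({..a} \<times> {..b})"
    using assms by (auto simp: dvd_two_prime_powers_iff image_iff)
  moreover have "inj_on (\<lambda>(i, j). p ^ i * q ^ j) ({..a} \<times> {..b})"
  proof (rule inj_onI)
    fix x y :: "nat \<times> nat"
    assume "(case x of (i, j) \<Rightarrow> p ^ i * q ^ j) = (case y of (i, j) \<Rightarrow> p ^ i * q ^ j)"
    then show "x = y"
      using prime_powers_cancel[OF assms] unfolding case_prod_unfold prod_eq_iff by blast
  qed
  ultimately show ?thesis
    by (simp add: divisor_sum_def sum.reindex sum.cartesian_product sum_product case_prod_unfold)
qed

text \<open>With \<open>p ^ a\<close> in front, division by n leaves a factor that depends on
  \<open>a\<close> only through u = \<open>1 / p ^ a\<close>.\<close>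

lemma sum_powers_ratio:
  fixes p :: nat
  assumes "1 < p"
  shows "real (\<Sum>i\<le>a. p ^ i) = p ^ a * ((p - 1 / p ^ a) / (real p - 1))"
proof -
  have "real (\<Sum>i\<le>a. p ^ i) = (real p ^ Suc a - 1) / (real p - 1)"
    using geometric_sum[of "real p" "Suc a"] assms by (simp add: lessThan_Suc_atMost)
  also have "\<dots> = p ^ a * ((p - 1 / p ^ a) / (real p - 1))"
    using assms by (simp add: field_simps)
  finally show ?thesis .
qed

text \<open>The sum has \<open>a + 1\<close> terms, all odd.\<close>

lemma odd_sum_powers_iff:
  fixes p :: nat
  assumes "odd p"
  shows "odd (\<Sum>i\<le>a. p ^ i) \<longleftrightarrow> even a"
  using assms by (induction a) auto

lemma two_prime_factors:
  fixes n :: nat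
  assumes "card (prime_factors n) = 2"
  obtains p q a b where "prime p" "prime q" "p < q" "0 < a" "0 < b" "n = p ^ a * q ^ b"
proof -
  from assms obtain p q where pq: "prime_factors n = {p, q}" "p \<noteq> q"
    by (auto simp: card_2_iff)
  have "n \<noteq> 0" using assms by (metis card.empty prime_factorization_0 set_mset_empty zero_neq_numeral)
  define P Q where "P = min p q" "Q = max p q"
  have PQ: "prime_factors n = {P, Q}" "P < Q"
    using pq unfolding P_Q_def by (auto simp: min_def max_def)
  have "n = P ^ multiplicity P n * Q ^ multiplicity Q n"
    using prime_factorization_nat[of n] \<open>n \<noteq> 0\<close> PQ by simp
  moreover have "prime P" "prime Q" "0 < multiplicity P n" "0 < multiplicity Q n"
    using PQ \<open>n \<noteq> 0\<close> by (auto simp: prime_factors_multiplicity)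
  ultimately show thesis using that PQ by blast
qed

text \<open>The complement \<open>e = n div d\<close> satisfies d/n = 1/e, so dividing the defining
  equation by n turns it into one about unit fractions. Properness of d becomes
  \<open>1 < e\<close>.\<close>

lemma deficient_perfect_complements:
  assumes "deficient_perfect_with n ds"
  obtains E where "finite E" "card E = length ds" "\<And>e. e \<in> E \<Longrightarrow> e dvd n \<and> 1 < e"
    "divisor_sum n / n + (\<Sum>e\<in>E. 1 / real e) = 2"
proof -
  have n: "0 < n" "distinct ds" "\<And>d. d \<in> set ds \<Longrightarrow> 0 < d \<and> d dvd n \<and> d < n"
    "int (divisor_sum n) = 2 * int n - int (sum_list ds)"
    using assms by (auto simp: deficient_perfect_with_def proper_divisor_def)
  have inj: "inj_on (\<lambda>d. n div d) (set ds)"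
  proof (rule inj_onI)
    fix x y assume xy: "x \<in> set ds" "y \<in> set ds" "n div x = n div y"
    then have "x * (n div x) = n" "y * (n div y) = n"
      using n(3)[of x] n(3)[of y] by auto
    with n(1) show "x = y" using xy(3) mult_cancel2[of x "n div x" y] by auto
  qed
  have "(\<Sum>e\<in>(\<lambda>d. n div d) ` set ds. 1 / real e) = (\<Sum>d\<in>set ds. d / n)"
    using n(3) by (simp add: sum.reindex[OF inj] real_of_nat_div)
  also have "\<dots> = sum_list ds / n"
    using n(2) by (simp add: sum_list_distinct_conv_sum_set[of ds "\<lambda>d. d", simplified] sum_divide_distrib)
  finally have *: "(\<Sum>e\<in>(\<lambda>d. n div d) ` set ds. 1 / real e) = sum_list ds / n" .
  have "real (divisor_sum n) = 2 * real n - real (sum_list ds)"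
    using n(4) by linarith
  then have "divisor_sum n / n + (\<Sum>e\<in>(\<lambda>d. n div d) ` set ds. 1 / real e) = 2"
    using n(1) unfolding * by (simp add: field_simps)
  moreover have "e dvd n \<and> 1 < e" if "e \<in> (\<lambda>d. n div d) ` set ds" for e
  proof -
    from that obtain d where "d \<in> set ds" "e = n div d" by auto
    with n(3)[of d] have d: "n = d * e" "d < n" "0 < d" by auto
    then have "e \<noteq> 0" "e \<noteq> 1" by (metis mult_0_right not_less0, metis mult.right_neutral less_irrefl)
    with d(1) show ?thesis by simp
  qed
  ultimately show thesis
    using n(2) inj by (intro that[of "(\<lambda>d. n div d) ` set ds"]) (simp_all add: card_image distinct_card)
qed

subsection \<open>The search for the smaller prime 3\<close>

text \<open>
  Here \<open>p = 3\<close>, \<open>u \<in> [ul, uh]\<close> and \<open>v \<in> [vl, vh]\<close>; \<open>k\<close> of the \<open>e\<^sub>i\<close> are still to be chosen from \<open>es\<close> or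
  from the numbers \<open>\<ge> 2187 = 3 ^ 7\<close>, and \<open>t\<close> is 2 minus the reciprocals already chosen.
  Each step splits the quantity that contributes most to the uncertainty of the left-hand side:
  for \<open>u\<close> and \<open>v\<close> either the upper end is attained or the exponent is larger by at least 2.
\<close>

fun search :: "nat \<Rightarrow> nat \<Rightarrow> real \<Rightarrow> real \<Rightarrow> real \<Rightarrow> real \<Rightarrow> nat \<Rightarrow> nat list \<Rightarrow> real \<Rightarrow> bool" where
  "search 0 q ul uh vl vh k es t = False"
| "search (Suc f) q ul uh vl vh k es t =
    (let w = k / real (hd (es @ [2187])) in
     if t < (3 - uh) * (q - vh) / (2 * (real q - 1)) then True
     else if (3 - ul) * (q - vl) / (2 * (real q - 1)) + w < t then True
     else if ul = uh \<and> vl = vh \<and> (1521 * (uh * vh) = 1 \<or> 225 * (uh * vh) = 1) then True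
     else if w \<le> uh - ul \<and> vh - vl \<le> uh - ul then
       (if search f q uh uh vl vh k es t then search f q 0 (uh / 9) vl vh k es t else False)
     else if w \<le> vh - vl then
       (if search f q ul uh vh vh k es t then search f q ul uh 0 (vh / q\<^sup>2) k es t else False)
     else (case es of [] \<Rightarrow> False | e # es' \<Rightarrow>
       (if search f q ul uh vl vh (k - 1) es' (t - 1 / e) then search f q ul uh vl vh k es' t else False)))"

text \<open>Lets the simplifier unfold \<open>search\<close> when the fuel is a numeral instead of a
  \<open>Suc\<close> term.\<close>

lemmas search_numeral = search.simps(2)[of "pred_numeral n" for n, folded numeral_eq_Suc]

text \<open>Sorted, so that the head of any remaining tail bounds all later choices from
  below.\<close>

definition candidates :: "nat \<Rightarrow> nat list" where
  "candidates q = sort (filter (\<lambda>e. 1 < e \<and> e < 2187) [3 ^ i * q ^ j. i \<leftarrow> [0..<7], j \<leftarrow> [0..<5]])"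

text \<open>\<open>l = h\<close> encodes that \<open>x\<close> is known exactly, \<open>l = 0\<close> that only the bound \<open>h\<close> is known.\<close>

definition geom_range :: "real \<Rightarrow> real \<Rightarrow> real \<Rightarrow> real \<Rightarrow> bool" where
  "geom_range c l h x \<longleftrightarrow> 0 < h \<and> h \<le> 1 \<and> (l = h \<and> x = h \<or> l = 0 \<and> (\<exists>i::nat. x = h / c ^ i))"

lemma geom_range_bounds:
  assumes "geom_range c l h x" "1 < c"
  shows "0 < x \<and> l \<le> x \<and> x \<le> h \<and> h \<le> 1"
proof -
  have "0 < h / c ^ i \<and> h / c ^ i \<le> h" if "0 < h" for i
    using that assms(2) one_le_power[of c i] by (simp add: pos_divide_le_eq)
  with assms(1) show ?thesis
    by (auto simp: geom_range_def less_imp_le)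
qed

text \<open>In \<open>x = h / c ^ i\<close> either \<open>i = 0\<close>, or one factor
  \<open>c\<close> is absorbed into the upper bound. These are the two branches of a split of u or v
  in \<open>search\<close>.\<close>

lemma geom_range_step:
  assumes "geom_range c l h x" "1 < c"
  shows "geom_range c h h x \<or> geom_range c 0 (h / c) x"
proof (cases "x = h")
  case False
  with assms(1) obtain i where i: "0 < h" "h \<le> 1" "x = h / c ^ i"
    by (auto simp: geom_range_def)
  with False obtain k where "i = Suc k" by (cases i) auto
  with i have "x = h / c / c ^ k" by simp
  moreover have "0 < h / c" "h / c \<le> 1"
    using i(1,2) assms(2) by (simp_all add: pos_divide_le_eq)
  ultimately show ?thesis
    unfolding geom_range_def by blast
next
  case True
  with assms(1) show ?thesis unfolding geom_range_def by blast
qed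

text \<open>Induction on the fuel. The product decreases in u and in v, so the interval ends enclose
  it, and the reciprocals sum to a value between 0 and \<open>w\<close>. A true solution therefore
  never meets the two pruning tests, and it follows one branch of every split.\<close>

lemma search_sound:
  assumes "search f q ul uh vl vh k es t"
    and "1 < q" "geom_range 9 ul uh u" "geom_range (q\<^sup>2) vl vh v"
    and "sorted es" "\<forall>e\<in>set es. 0 < e \<and> e < 2187"
    and "finite E" "card E = k" "E \<subseteq> set es \<union> {2187..}"
    and "(3 - u) * (q - v) / (2 * (real q - 1)) + (\<Sum>e\<in>E. 1 / real e) = t"
  shows "1521 * (u * v) = 1 \<or> 225 * (u * v) = 1"
  using assms
proof (induction f arbitrary: ul uh vl vh k es t E)
  case 0
  from "0.prems"(1) show ?case by (simp only: search.simps)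
next
  case (Suc f)
  define w where "w = k / real (hd (es @ [2187]))"
  have q: "1 < real q" "1 < (real q)\<^sup>2"
    using Suc.prems(2) by (simp_all add: one_less_power)
  note u = geom_range_bounds[OF Suc.prems(3)]
  note v = geom_range_bounds[OF Suc.prems(4)]
  have bounds: "0 < u" "ul \<le> u" "u \<le> uh" "uh \<le> 1" "0 < v" "vl \<le> v" "v \<le> vh" "vh \<le> 1"
    using u v q by auto
  have lower: "(3 - uh) * (q - vh) / (2 * (real q - 1)) \<le> (3 - u) * (q - v) / (2 * (real q - 1))"
    using bounds q by (intro divide_right_mono mult_mono) auto
  have upper: "(3 - u) * (q - v) / (2 * (real q - 1)) \<le> (3 - ul) * (q - vl) / (2 * (real q - 1))"
    using bounds q by (intro divide_right_mono mult_mono) auto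
  \<comment> \<open>The head of the sorted list is below 2187, hence also below the elements of
    \<open>E\<close> outside the list; 2187 itself is the default once the list is empty.\<close>
  have "e \<ge> hd (es @ [2187])" if "e \<in> E" for e
  proof (cases es)
    case Nil
    with that Suc.prems(9) show ?thesis by auto
  next
    case (Cons x xs)
    from that Suc.prems(9) have "e \<in> set es \<or> 2187 \<le> e" by auto
    with Cons Suc.prems(5,6) show ?thesis by auto
  qed
  then have "E \<subseteq> {} \<union> {hd (es @ [2187])..}" by auto
  moreover have "0 < hd (es @ [2187])"
    using Suc.prems(6) by (cases es) auto
  ultimately have "(\<Sum>e\<in>E. 1 / real e) \<le> w"
    using sum_inverse_le[of E "{}" "hd (es @ [2187])"] Suc.prems(7,8) by (simp add: w_def)
  moreover have "0 \<le> (\<Sum>e\<in>E. 1 / real e)"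
    by (intro sum_nonneg) simp
  ultimately have no_gap: "\<not> t < (3 - uh) * (q - vh) / (2 * (real q - 1))"
      "\<not> (3 - ul) * (q - vl) / (2 * (real q - 1)) + w < t"
    using lower upper Suc.prems(10) by linarith+
  consider (hit) "ul = uh" "vl = vh" "1521 * (uh * vh) = 1 \<or> 225 * (uh * vh) = 1"
    | (split_u) "search f q uh uh vl vh k es t" "search f q 0 (uh / 9) vl vh k es t"
    | (split_v) "search f q ul uh vh vh k es t" "search f q ul uh 0 (vh / q\<^sup>2) k es t"
    | (split_E) e es' where "es = e # es'"
        "search f q ul uh vl vh (k - 1) es' (t - 1 / e)" "search f q ul uh vl vh k es' t"
    using Suc.prems(1) no_gap unfolding search.simps(2) Let_def w_def[symmetric]
    by (simp split: if_splits list.splits)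
  then show ?case
  proof cases
    case hit
    with bounds have "u = uh" "v = vh" by auto
    with hit show ?thesis by simp
  next
    case split_u
    then show ?thesis
      using geom_range_step[OF Suc.prems(3)] Suc.IH Suc.prems(2,4-10) by auto
  next
    case split_v
    then show ?thesis
      using geom_range_step[OF Suc.prems(4)] q Suc.IH Suc.prems(2,3,5-10) by auto
  next
    case split_E
    show ?thesis
    \<comment> \<open>Choosing \<open>e\<close> moves its reciprocal to the right-hand side;
      discarding it only shortens the list.\<close>
    proof (cases "e \<in> E")
      case True
      then have "(\<Sum>e\<in>E. 1 / real e) = 1 / real e + (\<Sum>e\<in>E - {e}. 1 / real e)"
        using Suc.prems(7) by (intro sum.remove) auto
      then show ?thesis
        using True Suc.prems(5-10) split_E
        by (intro Suc.IH[OF split_E(2) Suc.prems(2-4), of "E - {e}"]) auto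
    next
      case False
      then show ?thesis
        using Suc.prems(5-10) split_E
        by (intro Suc.IH[OF split_E(3) Suc.prems(2-4), of E]) auto
    qed
  qed
qed

text \<open>Proved by executing the search in exact arithmetic for each \<open>q\<close>; fuel 30
  covers the depth of every search tree. Taking all odd \<open>q\<close> prime to 3 spares primality
  tests.\<close>

lemma search_succeeds:
  assumes "4 < q" "q < 83" "odd q" "\<not> 3 dvd q"
  shows "search 30 q 0 (1 / 9) 0 (1 / (real q)\<^sup>2) 3 (candidates q) 2"
proof -
  have "\<forall>q \<in> set (filter (\<lambda>q. odd q \<and> \<not> 3 dvd q) [5..<83]).
          search 30 q 0 (1 / 9) 0 (1 / (real q)\<^sup>2) 3 (candidates q) 2"
    by (simp add: candidates_def upt_rec search_numeral Let_def)
  moreover have "q \<in> set (filter (\<lambda>q. odd q \<and> \<not> 3 dvd q) [5..<83])"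
    unfolding set_filter set_upt using assms by simp
  ultimately show ?thesis by blast
qed

lemma mem_candidates:
  assumes "5 \<le> q" "1 < e" "e < 2187" "e = 3 ^ i * q ^ j"
  shows "e \<in> set (candidates q)"
proof -
  have "(3::nat) ^ i \<le> e" "q ^ j \<le> e"
    using assms by auto
  have "(3::nat) ^ i < 3 ^ 7"
    using \<open>3 ^ i \<le> e\<close> assms(3) by simp
  then have "i < 7" by (rule power_less_imp_less_exp[rotated]) simp
  \<comment> \<open>\<open>5 ^ j \<le> q ^ j \<le> e < 2187 < 3125 = 5 ^ 5\<close>.\<close>
  have "(5::nat) ^ j < 5 ^ 5"
    using \<open>q ^ j \<le> e\<close> assms(3) power_mono[OF assms(1), of j] by simp
  then have "j < 5" by (rule power_less_imp_less_exp[rotated]) simp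
  have "3 ^ i * q ^ j \<in> set [3 ^ i * q ^ j. i \<leftarrow> [0..<7], j \<leftarrow> [0..<5]]"
    unfolding set_concat set_map using \<open>i < 7\<close> \<open>j < 5\<close> by fastforce
  then show ?thesis
    using assms unfolding candidates_def by simp
qed

text \<open>An even positive exponent is 2(i + 1), so the reciprocal power starts at
  \<open>1 / p\<^sup>2\<close> and shrinks by factors \<open>p\<^sup>2\<close>.\<close>

lemma geom_range_power:
  assumes "1 < p" "even a" "0 < a"
  shows "geom_range ((real p)\<^sup>2) 0 (1 / (real p)\<^sup>2) (1 / p ^ a)"
proof -
  obtain i where i: "a = 2 * Suc i"
    using assms(2,3) by (elim evenE) (metis gr0_conv_Suc nat_0_less_mult_iff)
  have "1 / real p ^ a = 1 / (real p)\<^sup>2 / ((real p)\<^sup>2) ^ i"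
    unfolding i power_mult by simp
  moreover have "1 \<le> (real p)\<^sup>2"
    using assms(1) by simp
  ultimately show ?thesis
    using assms(1) by (auto simp: geom_range_def)
qed

section \<open>Reduction to p = 3, q < 83 and even exponents\<close>

text \<open>Each factor lies strictly below x/(x - 1), which decreases in x, so lower bounds for p
  and q may be inserted.\<close>

lemma abundancy_less:
  assumes "1 < P" "1 < Q" "P \<le> real p" "Q \<le> real q"
  shows "(p - 1 / p ^ a) / (real p - 1) * ((q - 1 / q ^ b) / (real q - 1)) < P / (P - 1) * (Q / (Q - 1))"
proof -
  have ratio: "0 \<le> (x - 1 / real x ^ c) / (real x - 1) \<and> (x - 1 / real x ^ c) / (real x - 1) < X / (X - 1)"
    if "1 < X" "X \<le> real x" for x c X
  proof -
    have "1 / real x ^ c \<le> 1" "0 < 1 / real x ^ c"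
      using that one_le_power[of "real x" c] by auto
    moreover have "x / (real x - 1) \<le> X / (X - 1)"
      using that by (simp add: frac_le_eq divide_le_0_iff field_simps)
    moreover have "(x - 1 / real x ^ c) / (real x - 1) < x / (real x - 1)"
      using that calculation(2) by (intro divide_strict_right_mono) auto
    moreover have "0 \<le> (x - 1 / real x ^ c) / (real x - 1)"
      using that calculation(1) by (intro divide_nonneg_nonneg) linarith+
    ultimately show ?thesis by linarith
  qed
  show ?thesis
    using ratio[OF assms(1,3)] ratio[OF assms(2,4)] assms(1,2)
    by (intro mult_strict_mono) auto
qed

lemma deficient_3_two_primes:
  assumes "odd n" "card (prime_factors n) = 2" "length ds = 3" "deficient_perfect_with n ds"
  shows "n = 1521 \<or> n = 225"
proof -
  obtain p q a b where pq: "prime p" "prime q" "p < q" "0 < a" "0 < b" "n = p ^ a * q ^ b"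
    using two_prime_factors[OF assms(2)] .
  have n0: "0 < n"
    using assms(4) by (simp add: deficient_perfect_with_def)
  have gt1: "1 < p" "1 < q"
    using pq prime_gt_1_nat by auto
  have odd: "odd p" "odd q"
    using assms(1) pq by auto
  then have p3: "3 \<le> p"
    using gt1 by presburger
  have q5: "5 \<le> q"
    using p3 pq(3) odd by presburger
  have sigma: "divisor_sum n = (\<Sum>i\<le>a. p ^ i) * (\<Sum>j\<le>b. q ^ j)"
    using divisor_sum_two_prime_powers pq by simp
  obtain E where E: "finite E" "card E = 3" "\<And>e. e \<in> E \<Longrightarrow> e dvd n \<and> 1 < e"
      "divisor_sum n / n + (\<Sum>e\<in>E. 1 / real e) = 2"
    using deficient_perfect_complements[OF assms(4)] assms(3) by metis
  have "real (divisor_sum n) = real (\<Sum>i\<le>a. p ^ i) * real (\<Sum>j\<le>b. q ^ j)"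
    by (simp only: sigma of_nat_mult)
  also have "\<dots> = n * ((p - 1 / p ^ a) / (real p - 1) * ((q - 1 / q ^ b) / (real q - 1)))"
    unfolding sum_powers_ratio[OF gt1(1)] sum_powers_ratio[OF gt1(2)] by (simp add: pq(6))
  finally have "real (divisor_sum n) / n = (p - 1 / p ^ a) / (real p - 1) * ((q - 1 / q ^ b) / (real q - 1))"
    using n0 by simp
  with E(4) have eq: "(p - 1 / p ^ a) / (real p - 1) * ((q - 1 / q ^ b) / (real q - 1)) + (\<Sum>e\<in>E. 1 / real e) = 2"
    by simp
  have odd_E: "odd e" if "e \<in> E" for e
    using E(3)[OF that] assms(1) dvd_trans by blast
  have "p = 3"
  proof (rule ccontr)
    assume "p \<noteq> 3"
    with p3 odd have "5 \<le> p" by presburger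
    with pq(3) odd have "7 \<le> q" by presburger
    have "\<not> 3 dvd n"
      using pq \<open>5 \<le> p\<close> \<open>7 \<le> q\<close>
      by (auto simp: prime_dvd_mult_iff prime_dvd_power_iff primes_dvd_imp_eq dest: primes_dvd_imp_eq[rotated 2])
    have "e = 5 \<or> 7 \<le> e" if "e \<in> E" for e
    proof -
      have "e \<noteq> 3" using E(3)[OF that] \<open>\<not> 3 dvd n\<close> by auto
      moreover have "1 < e" "odd e" using E(3) odd_E that by auto
      ultimately show ?thesis by presburger
    qed
    \<comment> \<open>The reciprocals give at most 1/5 + 2/7 = 17/35 and the product is below 5/4 *
      7/6 = 35/24; together this is 1633/840 < 2.\<close>
    then have "(\<Sum>e\<in>E. 1 / real e) \<le> 3 / 7 + (1 / 5 - 1 / 7)"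
      using sum_inverse_le[of E "{5}" 7] E(1,2) by auto
    with eq abundancy_less[of 5 7 p q a b] \<open>5 \<le> p\<close> \<open>7 \<le> q\<close> show False by simp
  qed
  \<comment> \<open>The reciprocals give at most 1/3 + 1/9 + 1/27 = 13/27. The product bound 3/2 *
    q/(q - 1) is at most 2 - 13/27 = 41/27 exactly when q is at least 82, and 83 is the first odd
    such value.\<close>
  have "q < 83"
  proof (rule ccontr)
    assume "\<not> q < 83"
    have "e \<in> {3, 9} \<or> 27 \<le> e" if e: "e \<in> E" for e
    proof -
      obtain i j where ij: "e = 3 ^ i * q ^ j"
        using E(3)[OF e] pq \<open>p = 3\<close> dvd_two_prime_powers_iff by blast
      show ?thesis
      proof (cases "j = 0")
        case True
        show ?thesis
        proof (cases "i < 3")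
          case True
          then have "i = 0 \<or> i = 1 \<or> i = 2" by auto
          with \<open>j = 0\<close> ij E(3)[OF e] show ?thesis by auto
        next
          case False
          with \<open>j = 0\<close> ij power_increasing[of 3 i "3::nat"] show ?thesis by simp
        qed
      next
        case False
        then have "q dvd e" using ij by simp
        then have "q \<le> e" using E(3)[OF e] by (auto intro: dvd_imp_le)
        with \<open>\<not> q < 83\<close> show ?thesis by simp
      qed
    qed
    then have "(\<Sum>e\<in>E. 1 / real e) \<le> 3 / 27 + (1 / 3 - 1 / 27 + (1 / 9 - 1 / 27))"
      using sum_inverse_le[of E "{3, 9}" 27] E(1,2) by auto
    with eq abundancy_less[of 3 83 p q a b] \<open>p = 3\<close> \<open>\<not> q < 83\<close> show False by simp
  qed
  have even: "even a" "even b"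
  proof -
    have "odd d" if "d \<in> set ds" for d
      using that assms(1,4) dvd_trans by (auto simp: deficient_perfect_with_def proper_divisor_def)
    moreover obtain x y z where "ds = [x, y, z]"
      using assms(3) by (auto simp: numeral_3_eq_3 length_Suc_conv)
    \<comment> \<open>A sum of three odd numbers.\<close>
    ultimately have "odd (sum_list ds)" by simp
    moreover have "int (divisor_sum n) + int (sum_list ds) = 2 * int n"
      using assms(4) by (simp add: deficient_perfect_with_def)
    ultimately have "odd (divisor_sum n)" by presburger
    then show "even a" "even b"
      unfolding sigma using odd odd_sum_powers_iff by auto
  qed
  have not3: "\<not> 3 dvd q"
    using pq(2) q5 primes_dvd_imp_eq[of 3 q] by auto
  define u v where "u = 1 / real p ^ a" and "v = 1 / real q ^ b"
  \<comment> \<open>As uv = 1/n, this says that n is 1521 or 225.\<close>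
  have "1521 * (u * v) = 1 \<or> 225 * (u * v) = 1"
  proof (rule search_sound)
    show "search 30 q 0 (1 / 9) 0 (1 / (real q)\<^sup>2) 3 (candidates q) 2"
      using search_succeeds q5 \<open>q < 83\<close> odd not3 by simp
    show "1 < q" by fact
    show "geom_range 9 0 (1 / 9) u"
      using geom_range_power[OF gt1(1) even(1) pq(4)] \<open>p = 3\<close> by (simp add: u_def)
    show "geom_range ((real q)\<^sup>2) 0 (1 / (real q)\<^sup>2) v"
      using geom_range_power[OF gt1(2) even(2) pq(5)] by (simp add: v_def)
    show "sorted (candidates q)" "\<forall>e\<in>set (candidates q). 0 < e \<and> e < 2187"
      by (simp_all add: candidates_def)
    show "finite E" "card E = 3" by fact+
    show "E \<subseteq> set (candidates q) \<union> {2187..}"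
    proof
      fix e assume e: "e \<in> E"
      obtain i j where "e = 3 ^ i * q ^ j"
        using E(3)[OF e] pq \<open>p = 3\<close> dvd_two_prime_powers_iff by blast
      then show "e \<in> set (candidates q) \<union> {2187..}"
        using mem_candidates[OF q5, of e i j] E(3)[OF e] by (cases "e < 2187") auto
    qed
    show "(3 - u) * (q - v) / (2 * (real q - 1)) + (\<Sum>e\<in>E. 1 / real e) = 2"
      using eq \<open>p = 3\<close> by (simp add: u_def v_def)
  qed
  moreover have "u * v = 1 / n"
    using pq(6) by (simp add: u_def v_def)
  ultimately have "real n = 1521 \<or> real n = 225"
    using n0 by (simp add: field_simps)
  then show ?thesis by linarith
qed

section \<open>The two surviving values 225 and 1521\<close>

text \<open>The search cannot reject 225: it allows any \<open>3 ^ i * 5 ^ j\<close> as e, and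
  47/225 = 1/5 + 1/135 + 1/675, although 135 and 675 do not divide 225. Here the actual divisors are
  tested: no three distinct ones sum to 2 * 225 - 403 = 47.\<close>

lemma not_exactly_deficient_perfect_225: "\<not> exactly_deficient_perfect 3 225"
proof
  assume "exactly_deficient_perfect 3 225"
  then obtain ds where ds: "length ds = 3" "deficient_perfect_with 225 ds"
    by (auto simp: exactly_deficient_perfect_def)
  then obtain x y z where xyz: "ds = [x, y, z]"
    by (auto simp: numeral_3_eq_3 length_Suc_conv)
  have pr: "prime (3::nat)" "prime (5::nat)" by simp_all
  have "divisor_sum 225 = 403"
    using divisor_sum_two_prime_powers[OF pr, of 2 2] by (simp add: numeral_2_eq_2)
  with ds xyz have "x + y + z = 47" and neq: "x \<noteq> y" "x \<noteq> z" "y \<noteq> z"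
      and dvd: "x dvd 225" "y dvd 225" "z dvd 225" 
    by (auto simp: deficient_perfect_with_def proper_divisor_def)
  have "d \<in> {1, 3, 5, 9, 15, 25, 45} \<or> 75 \<le> d" if d: "d dvd 225" for d :: nat
  proof -
    obtain i j where "i \<le> 2" "j \<le> 2" "d = 3 ^ i * 5 ^ j"
      using dvd_two_prime_powers_iff[OF pr, of d 2 2] d by auto
    moreover from this have "i = 0 \<or> i = 1 \<or> i = 2" "j = 0 \<or> j = 1 \<or> j = 2" by auto
    ultimately show ?thesis by auto
  qed
  from this[OF dvd(1)] this[OF dvd(2)] this[OF dvd(3)] \<open>x + y + z = 47\<close> neq
  show False by auto
qed

lemma deficient_perfect_1521: "deficient_perfect_with 1521 [507, 117, 39]"
proof -
  have pr: "prime (3::nat)" "prime (13::nat)" by simp_all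
  have "divisor_sum 1521 = 2379"
    using divisor_sum_two_prime_powers[OF pr, of 2 2] by (simp add: numeral_2_eq_2)
  then show ?thesis
    by (simp add: deficient_perfect_with_def proper_divisor_def)
qed

theorem theorem1:
  shows "(\<forall>n::nat. 0 < n \<and> odd n \<and> card (prime_factors n) = 2 \<longrightarrow>
            (exactly_deficient_perfect 3 n \<longleftrightarrow> n = 1521)) \<and>
         (1521::nat) = 3 ^ 2 * 13 ^ 2 \<and>
         deficient_perfect_with 1521 [507, 117, 39] \<and>
         int (divisor_sum 1521) = 2 * 1521 - (507 + 117 + 39)"
proof (intro conjI allI impI)
  fix n :: nat
  assume n: "0 < n \<and> odd n \<and> card (prime_factors n) = 2"
  show "exactly_deficient_perfect 3 n \<longleftrightarrow> n = 1521"
  proof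
    assume "exactly_deficient_perfect 3 n"
    with n deficient_3_two_primes not_exactly_deficient_perfect_225 show "n = 1521"
      unfolding exactly_deficient_perfect_def by metis
  next
    assume "n = 1521"
    then show "exactly_deficient_perfect 3 n"
      unfolding exactly_deficient_perfect_def
      using deficient_perfect_1521 by (intro exI[of _ "[507, 117, 39]"]) simp
  qed
next
  show "deficient_perfect_with 1521 [507, 117, 39]"
    by (fact deficient_perfect_1521)
  then show "int (divisor_sum 1521) = 2 * 1521 - (507 + 117 + 39)"
    by (simp add: deficient_perfect_with_def)
qed simp

end
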